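(* Let $n\ge2$. Each $L_i$, $1\le i\le n$, is irreducible over the unit ball of $\mathfrak{L}_n$; that is, if $L_i=BC$ with $B,C\in\mathfrak{L}_n$, $\|B\|\le 1$ and $\|C\|\le1$, then $B$ or $C$ is a scalar multiple $\lambda I$ of the identity with $|\lambda|=1$.
   Context: Let $\mathcal{F}_n$ be the unital free semigroup on $n$ generators $z_1,\dots,z_n$ (its unit is the empty word $1$), and let $\mathcal{H}_n=\ell_2(\mathcal{F}_n)$, with orthonormal basis $\{\xi_w: w\in\mathcal{F}_n\}$. Let $L_i$ be the isometry on $\mathcal{H}_n$ with $L_i\xi_v=\xi_{z_iv}$. The non-commutative analytic Toeplitz algebra $\mathfrak{L}_n$ is the unital algebra, closed in the weak operator topology, generated by $L_1,\dots,L_n$ in $\mathcal{B}(\mathcal{H}_n)$. *)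

theory Defs
  imports "HOL-Analysis.Analysis"
begin

section \<open>The complex Hilbert space of square-summable families\<close>

typedef 'a ell2 = "{f :: 'a \<Rightarrow> complex. (\<lambda>x. (cmod (f x))\<^sup>2) summable_on UNIV}"
  morphisms coord Abs_ell2
  by (rule exI[of _ "\<lambda>_. 0"]) simp

setup_lifting type_definition_ell2

lemma ell2_summable_mult:
  fixes f g :: "'a \<Rightarrow> complex"
  assumes "(\<lambda>x. (cmod (f x))\<^sup>2) summable_on UNIV" "(\<lambda>x. (cmod (g x))\<^sup>2) summable_on UNIV"
  shows "(\<lambda>x. f x * cnj (g x)) summable_on UNIV"
proof -
  have s: "(\<lambda>x. (cmod (f x))\<^sup>2 + (cmod (g x))\<^sup>2) summable_on UNIV"
    using assms by (rule summable_on_add)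
  have "cmod (f x * cnj (g x)) \<le> (cmod (f x))\<^sup>2 + (cmod (g x))\<^sup>2" for x
  proof -
    have "2 * (cmod (f x) * cmod (g x)) \<le> (cmod (f x))\<^sup>2 + (cmod (g x))\<^sup>2"
      using sum_squares_bound[of "cmod (f x)" "cmod (g x)"] by simp
    moreover have "0 \<le> cmod (f x) * cmod (g x)" by simp
    ultimately show ?thesis unfolding norm_mult complex_mod_cnj by linarith
  qed
  then have "(\<lambda>x. cmod (f x * cnj (g x))) summable_on UNIV"
    by (intro summable_on_comparison_test[OF s]) auto
  then show ?thesis by (rule abs_summable_summable)
qed

lemma ell2_summable_add:
  fixes f g :: "'a \<Rightarrow> complex"
  assumes "(\<lambda>x. (cmod (f x))\<^sup>2) summable_on UNIV" "(\<lambda>x. (cmod (g x))\<^sup>2) summable_on UNIV"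
  shows "(\<lambda>x. (cmod (f x + g x))\<^sup>2) summable_on UNIV"
proof -
  have s: "(\<lambda>x. 2 * (cmod (f x))\<^sup>2 + 2 * (cmod (g x))\<^sup>2) summable_on UNIV"
    using assms by (intro summable_on_add summable_on_cmult_right)
  have "(cmod (f x + g x))\<^sup>2 \<le> 2 * (cmod (f x))\<^sup>2 + 2 * (cmod (g x))\<^sup>2" for x
  proof -
    have "(cmod (f x + g x))\<^sup>2 \<le> (cmod (f x) + cmod (g x))\<^sup>2"
      by (intro power_mono norm_triangle_ineq) simp
    also have "\<dots> \<le> 2 * (cmod (f x))\<^sup>2 + 2 * (cmod (g x))\<^sup>2"
      using sum_squares_bound[of "cmod (f x)" "cmod (g x)"] by (simp add: power2_sum)
    finally show ?thesis .
  qed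
  then show ?thesis
    by (intro summable_on_comparison_test[OF s]) auto
qed

lemma ell2_summable_scale:
  fixes f :: "'a \<Rightarrow> complex"
  assumes "(\<lambda>x. (cmod (f x))\<^sup>2) summable_on UNIV"
  shows "(\<lambda>x. (cmod (c * f x))\<^sup>2) summable_on UNIV"
  using summable_on_cmult_right[OF assms, of "(cmod c)\<^sup>2"]
  by (simp add: norm_mult power_mult_distrib)

lift_definition scaleC :: "complex \<Rightarrow> 'a ell2 \<Rightarrow> 'a ell2" (infixr \<open>*\<^sub>C\<close> 75)
  is "\<lambda>c f x. c * f x"
  by (rule ell2_summable_scale)

lift_definition cinner :: "'a ell2 \<Rightarrow> 'a ell2 \<Rightarrow> complex"
  is "\<lambda>f g. \<Sum>\<^sub>\<infinity>x. f x * cnj (g x)" .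

text \<open>The library offers normed and inner product spaces over the reals only. The real inner
  product below is the real part of the complex one; both induce the same norm.\<close>

instantiation ell2 :: (type) real_inner
begin

lift_definition zero_ell2 :: "'a ell2" is "\<lambda>_. 0" by simp

lift_definition plus_ell2 :: "'a ell2 \<Rightarrow> 'a ell2 \<Rightarrow> 'a ell2" is "\<lambda>f g x. f x + g x"
  by (rule ell2_summable_add)

lift_definition uminus_ell2 :: "'a ell2 \<Rightarrow> 'a ell2" is "\<lambda>f x. - f x" by simp

lift_definition minus_ell2 :: "'a ell2 \<Rightarrow> 'a ell2 \<Rightarrow> 'a ell2" is "\<lambda>f g x. f x - g x"
proof -
  fix f g :: "'a \<Rightarrow> complex"
  assume "(\<lambda>x. (cmod (f x))\<^sup>2) summable_on UNIV" "(\<lambda>x. (cmod (g x))\<^sup>2) summable_on UNIV"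
  then show "(\<lambda>x. (cmod (f x - g x))\<^sup>2) summable_on UNIV"
    using ell2_summable_add[of f "\<lambda>x. - g x"] by simp
qed

lift_definition scaleR_ell2 :: "real \<Rightarrow> 'a ell2 \<Rightarrow> 'a ell2" is "\<lambda>r f x. complex_of_real r * f x"
  by (rule ell2_summable_scale)

definition inner_ell2 :: "'a ell2 \<Rightarrow> 'a ell2 \<Rightarrow> real" where
  "inner_ell2 f g = Re (cinner f g)"

definition norm_ell2 :: "'a ell2 \<Rightarrow> real" where
  "norm_ell2 f = sqrt (inner f f)"

definition sgn_ell2 :: "'a ell2 \<Rightarrow> 'a ell2" where
  "sgn_ell2 f = scaleR (inverse (norm f)) f"

definition dist_ell2 :: "'a ell2 \<Rightarrow> 'a ell2 \<Rightarrow> real" where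
  "dist_ell2 f g = norm (f - g)"

definition uniformity_ell2 :: "('a ell2 \<times> 'a ell2) filter" where
  "uniformity_ell2 = (INF e\<in>{0<..}. principal {(f, g). dist f g < e})"

definition open_ell2 :: "'a ell2 set \<Rightarrow> bool" where
  "open_ell2 U \<longleftrightarrow> (\<forall>f\<in>U. eventually (\<lambda>(f', g). f' = f \<longrightarrow> g \<in> U) uniformity)"

lemma cinner_summable: "(\<lambda>x. coord f x * cnj (coord g x)) summable_on UNIV"
  for f g :: "'a ell2"
  using coord[of f] coord[of g] by (intro ell2_summable_mult) auto

lemma inner_ell2_self: "inner f f = (\<Sum>\<^sub>\<infinity>x. (cmod (coord f x))\<^sup>2)" for f :: "'a ell2"
proof -
  have "coord f x * cnj (coord f x) = complex_of_real ((cmod (coord f x))\<^sup>2)" for x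
    by (rule complex_norm_square[symmetric])
  then have "Re (coord f x * cnj (coord f x)) = (cmod (coord f x))\<^sup>2" for x
    by (simp only: Re_complex_of_real)
  then show ?thesis
    by (simp only: inner_ell2_def cinner.rep_eq infsum_Re[OF cinner_summable, symmetric])
qed

instance
proof
  fix f g h :: "'a ell2" and r s :: real
  show "f + g + h = f + (g + h)" "f + g = g + f" "0 + f = f" "- f + f = 0" "f - g = f + - g"
    by (transfer; simp add: algebra_simps)+
  show "r *\<^sub>R (f + g) = r *\<^sub>R f + r *\<^sub>R g" "(r + s) *\<^sub>R f = r *\<^sub>R f + s *\<^sub>R f"
    "r *\<^sub>R s *\<^sub>R f = (r * s) *\<^sub>R f" "1 *\<^sub>R f = f"
    by (transfer; simp add: algebra_simps)+
  show "sgn f = scaleR (inverse (norm f)) f" by (fact sgn_ell2_def)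
  show "dist f g = norm (f - g)" by (fact dist_ell2_def)
  show "(uniformity :: ('a ell2 \<times> 'a ell2) filter)
      = (INF e\<in>{0<..}. principal {(f, g). dist f g < e})"
    by (fact uniformity_ell2_def)
  show "open U \<longleftrightarrow> (\<forall>f\<in>U. eventually (\<lambda>(f', g). f' = f \<longrightarrow> g \<in> U) uniformity)"
    for U :: "'a ell2 set"
    by (fact open_ell2_def)
  show "norm f = sqrt (inner f f)" by (fact norm_ell2_def)
  show "inner f g = inner g f"
  proof -
    have "cinner f g = cnj (cinner g f)"
      by (simp add: cinner.rep_eq mult.commute flip: infsum_cnj)
    then show ?thesis by (simp add: inner_ell2_def)
  qed
  show "inner (f + g) h = inner f h + inner g h"
    using infsum_add[OF cinner_summable[of f h] cinner_summable[of g h]]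
    by (simp add: inner_ell2_def cinner.rep_eq plus_ell2.rep_eq distrib_right)
  show "inner (r *\<^sub>R f) g = r * inner f g"
    by (simp add: inner_ell2_def cinner.rep_eq scaleR_ell2.rep_eq mult.assoc infsum_cmult_right')
  show "0 \<le> inner f f"
    by (simp add: inner_ell2_self infsum_nonneg)
  show "inner f f = 0 \<longleftrightarrow> f = 0"
  proof
    assume "inner f f = 0"
    then have "(\<Sum>\<^sub>\<infinity>x. (cmod (coord f x))\<^sup>2) = 0" by (simp add: inner_ell2_self)
    then have "(cmod (coord f x))\<^sup>2 = 0" for x
      using coord[of f] by (intro nonneg_infsum_le_0D[where A = UNIV]) auto
    then show "f = 0"
      by (simp add: coord_inject[symmetric] zero_ell2.rep_eq fun_eq_iff)
  next
    assume "f = 0"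
    then show "inner f f = 0" by (simp add: inner_ell2_self zero_ell2.rep_eq)
  qed
qed

end

lemma norm_ell2_eq: "norm f = sqrt (\<Sum>\<^sub>\<infinity>x. (cmod (coord f x))\<^sup>2)"
  by (simp add: norm_ell2_def inner_ell2_self)

lemma norm_scaleC: "norm (c *\<^sub>C f) = cmod c * norm f"
  by (simp add: norm_ell2_eq scaleC.rep_eq norm_mult power_mult_distrib infsum_cmult_right'
      real_sqrt_mult)

lemma scaleC_of_real: "complex_of_real r *\<^sub>C f = r *\<^sub>R f"
  by transfer simp

lemma ket_summable:
  "(\<lambda>x. (cmod (if x = v then 1 else 0))\<^sup>2) summable_on UNIV"
proof -
  have "(\<lambda>x. (cmod (if x = v then 1 else 0))\<^sup>2) summable_on {v}" by simp
  also have "?this \<longleftrightarrow> (\<lambda>x. (cmod (if x = v then 1 else 0))\<^sup>2) summable_on UNIV"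
    by (rule summable_on_cong_neutral) auto
  finally show ?thesis .
qed

lift_definition ket :: "'a \<Rightarrow> 'a ell2" is "\<lambda>v x. if x = v then 1 else 0"
  by (rule ket_summable)

lemma cinner_ket: "cinner f (ket v) = coord f v"
proof -
  have "(\<Sum>\<^sub>\<infinity>x. coord f x * cnj (if x = v then 1 else 0))
      = (\<Sum>\<^sub>\<infinity>x\<in>{v}. coord f x * cnj (if x = v then 1 else 0))"
    by (rule infsum_cong_neutral) auto
  then show ?thesis by (simp add: cinner.rep_eq ket.rep_eq)
qed


section \<open>Bounded operators and the weak operator topology\<close>

text \<open>\<open>\<Rightarrow>\<^sub>L\<close> is the type of bounded real-linear maps with the operator norm; the complex-linear
  ones among them form the algebra of bounded operators on the complex Hilbert space.\<close>

definition bounded_ops :: "('a ell2 \<Rightarrow>\<^sub>L 'a ell2) set" where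
  "bounded_ops = {T. \<forall>c f. blinfun_apply T (c *\<^sub>C f) = c *\<^sub>C blinfun_apply T f}"

lemma bounded_linear_scaleC: "bounded_linear (\<lambda>f. c *\<^sub>C f)"
proof (rule bounded_linear_intro)
  show "c *\<^sub>C (f + g) = c *\<^sub>C f + c *\<^sub>C g" for f g :: "'a ell2"
    by transfer (simp add: distrib_left)
  show "c *\<^sub>C (r *\<^sub>R f) = r *\<^sub>R (c *\<^sub>C f)" for r and f :: "'a ell2"
    by transfer (simp add: algebra_simps)
  show "norm (c *\<^sub>C f) \<le> norm f * cmod c" for f :: "'a ell2"
    by (simp add: norm_scaleC mult.commute)
qed

definition scale_op :: "complex \<Rightarrow> ('a ell2 \<Rightarrow>\<^sub>L 'a ell2) \<Rightarrow> ('a ell2 \<Rightarrow>\<^sub>L 'a ell2)" where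
  "scale_op c T = Blinfun (\<lambda>f. c *\<^sub>C blinfun_apply T f)"

lemma scale_op_apply: "blinfun_apply (scale_op c T) f = c *\<^sub>C blinfun_apply T f"
  unfolding scale_op_def
  by (subst bounded_linear_Blinfun_apply)
    (rule bounded_linear_compose[OF bounded_linear_scaleC blinfun.bounded_linear_right] refl)+

text \<open>The weak operator topology is the initial topology for the functionals
  \<open>T \<mapsto> \<langle>T f, g\<rangle>\<close>, i.e. the pullback of the product topology along the map that collects
  all of them.\<close>

definition weak_operator_topology :: "('a ell2 \<Rightarrow>\<^sub>L 'a ell2) topology" where
  "weak_operator_topology =
     pullback_topology bounded_ops (\<lambda>T (f, g). cinner (blinfun_apply T f) g)
       (product_topology (\<lambda>_. euclidean) UNIV)"

definition unital_subalgebra :: "('a ell2 \<Rightarrow>\<^sub>L 'a ell2) set \<Rightarrow> bool" where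
  "unital_subalgebra A \<longleftrightarrow>
     A \<subseteq> bounded_ops \<and> id_blinfun \<in> A \<and>
     (\<forall>S\<in>A. \<forall>T\<in>A. S + T \<in> A) \<and>
     (\<forall>c. \<forall>T\<in>A. scale_op c T \<in> A) \<and>
     (\<forall>S\<in>A. \<forall>T\<in>A. S o\<^sub>L T \<in> A)"


section \<open>The non-commutative analytic Toeplitz algebra\<close>

text \<open>The free semigroup on the letters of \<open>'n\<close> is \<open>'n list\<close> under concatenation, with the
  empty word as its unit.\<close>

definition prepend :: "'n \<Rightarrow> ('n list \<Rightarrow> complex) \<Rightarrow> 'n list \<Rightarrow> complex" where
  "prepend i f w = (case w of [] \<Rightarrow> 0 | j # v \<Rightarrow> if j = i then f v else 0)"

lemma prepend_infsum:
  "(\<lambda>w. (cmod (prepend i f w))\<^sup>2) summable_on UNIV \<longleftrightarrow> (\<lambda>v. (cmod (f v))\<^sup>2) summable_on UNIV"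
  "(\<Sum>\<^sub>\<infinity>w. (cmod (prepend i f w))\<^sup>2) = (\<Sum>\<^sub>\<infinity>v. (cmod (f v))\<^sup>2)"
proof -
  let ?h = "\<lambda>w. (cmod (prepend i f w))\<^sup>2"
  have inj: "inj ((#) i)" by (simp add: inj_on_def)
  have comp: "?h \<circ> (#) i = (\<lambda>v. (cmod (f v))\<^sup>2)"
    by (simp add: prepend_def fun_eq_iff)
  have zero: "?h w = 0" if "w \<notin> range ((#) i)" for w
    using that by (cases w) (auto simp: prepend_def)
  have "?h summable_on UNIV \<longleftrightarrow> ?h summable_on range ((#) i)"
    by (rule summable_on_cong_neutral) (use zero in auto)
  also have "\<dots> \<longleftrightarrow> (\<lambda>v. (cmod (f v))\<^sup>2) summable_on UNIV"
    by (simp only: summable_on_reindex[OF inj] comp)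
  finally show "?h summable_on UNIV \<longleftrightarrow> (\<lambda>v. (cmod (f v))\<^sup>2) summable_on UNIV" .
  have "infsum ?h UNIV = infsum ?h (range ((#) i))"
    by (rule infsum_cong_neutral) (use zero in auto)
  also have "\<dots> = (\<Sum>\<^sub>\<infinity>v. (cmod (f v))\<^sup>2)"
    by (simp only: infsum_reindex[OF inj] comp)
  finally show "infsum ?h UNIV = (\<Sum>\<^sub>\<infinity>v. (cmod (f v))\<^sup>2)" .
qed

lift_definition prepend_ell2 :: "'n \<Rightarrow> 'n list ell2 \<Rightarrow> 'n list ell2" is prepend
  by (simp add: prepend_infsum)

lemma norm_prepend_ell2: "norm (prepend_ell2 i f) = norm f"
  by (simp add: norm_ell2_eq prepend_ell2.rep_eq prepend_infsum)

lemma bounded_linear_prepend_ell2: "bounded_linear (prepend_ell2 i)"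
proof (rule bounded_linear_intro)
  fix f g :: "'a list ell2" and r :: real
  show "prepend_ell2 i (f + g) = prepend_ell2 i f + prepend_ell2 i g"
    by transfer (auto simp: prepend_def fun_eq_iff split: list.split)
  show "prepend_ell2 i (r *\<^sub>R f) = r *\<^sub>R prepend_ell2 i f"
    by transfer (auto simp: prepend_def fun_eq_iff split: list.split)
  show "norm (prepend_ell2 i f) \<le> norm f * 1"
    by (simp add: norm_prepend_ell2)
qed

definition left_creation :: "'n \<Rightarrow> 'n list ell2 \<Rightarrow>\<^sub>L 'n list ell2" where
  "left_creation i = Blinfun (prepend_ell2 i)"

lemma left_creation_apply: "blinfun_apply (left_creation i) f = prepend_ell2 i f"
  by (simp add: left_creation_def bounded_linear_Blinfun_apply bounded_linear_prepend_ell2)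

lemma norm_left_creation: "norm (blinfun_apply (left_creation i) f) = norm f"
  by (simp add: left_creation_apply norm_prepend_ell2)

lemma left_creation_in_bounded_ops: "left_creation i \<in> bounded_ops"
proof -
  have "prepend_ell2 i (c *\<^sub>C f) = c *\<^sub>C prepend_ell2 i f" for c and f :: "'a list ell2"
    by transfer (auto simp: prepend_def fun_eq_iff split: list.split)
  then show ?thesis by (simp add: bounded_ops_def left_creation_apply)
qed

lemma left_creation_ket: "blinfun_apply (left_creation i) (ket v) = ket (i # v)"
  by (auto simp: coord_inject[symmetric] left_creation_apply prepend_ell2.rep_eq ket.rep_eq
      prepend_def fun_eq_iff split: list.split)

definition toeplitz_algebra :: "('n list ell2 \<Rightarrow>\<^sub>L 'n list ell2) set" where
  "toeplitz_algebra =
     (\<lambda>A. unital_subalgebra A \<and> closedin weak_operator_topology A) hull range left_creation"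

end

theory Submission
  imports Defs
begin

text \<open>Every element \<open>T\<close> of the algebra commutes with appending a letter at the right end of
  words, because the generators do and the commutant is a unital algebra closed in the weak
  operator topology (\<open>toeplitz_algebra_subset\<close>). Hence \<open>T\<close> is determined by the Fourier
  coefficients \<open>t\<^sub>w\<close>, the coordinates of \<open>T \<xi>\<^sub>1\<close>, and in low degree these multiply as for power
  series: writing \<open>b\<^sub>w\<close> and \<open>c\<^sub>w\<close> for the coefficients of \<open>B\<close> and \<open>C\<close>, the identity
  \<open>L\<^sub>i = B C\<close> gives \<open>b\<^sub>1 c\<^sub>1 = 0\<close> in degree zero and \<open>c\<^sub>1 b\<^sub>i + b\<^sub>1 c\<^sub>i = 1\<close> at the letter \<open>i\<close>.

  One of \<open>b\<^sub>1\<close>, \<open>c\<^sub>1\<close> therefore vanishes. If \<open>b\<^sub>1 = 0\<close> then \<open>c\<^sub>1 b\<^sub>i = 1\<close>; coefficients of a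
  contraction have modulus at most one, so \<open>\<bar>c\<^sub>1\<bar> = 1\<close>. As \<open>C \<xi>\<^sub>1\<close> has norm at most one, all
  its other coordinates are zero, and so \<open>C = c\<^sub>1 I\<close> (\<open>commutant_contraction_eq_scalar\<close>). If
  \<open>c\<^sub>1 = 0\<close>, the same argument applies to \<open>B\<close>.\<close>

section \<open>Coordinates of vectors\<close>

lemmas coord_simps =
  zero_ell2.rep_eq plus_ell2.rep_eq scaleC.rep_eq ket.rep_eq

lemma ell2_eqI: "f = g" if "\<And>x. coord f x = coord g x"
  using that by (simp add: coord_inject[symmetric] fun_eq_iff)

lemma coord_sum: "coord (\<Sum>a\<in>A. h a) x = (\<Sum>a\<in>A. coord (h a) x)"
  by (induction A rule: infinite_finite_induct) (simp_all add: coord_simps)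

lemma sum_coord_le_norm:
  assumes "finite F"
  shows "(\<Sum>x\<in>F. (cmod (coord f x))\<^sup>2) \<le> (norm f)\<^sup>2"
proof -
  have "(\<Sum>x\<in>F. (cmod (coord f x))\<^sup>2) \<le> (\<Sum>\<^sub>\<infinity>x. (cmod (coord f x))\<^sup>2)"
    using coord[of f] assms by (intro finite_sum_le_infsum) auto
  also have "\<dots> = (norm f)\<^sup>2"
    by (simp add: norm_ell2_eq infsum_nonneg)
  finally show ?thesis .
qed

lemma coord_le_norm: "cmod (coord f x) \<le> norm f"
  using sum_coord_le_norm[of "{x}" f] by (simp add: power2_le_iff_abs_le)

lemma norm_ket: "norm (ket x) = 1"
proof -
  have "(\<Sum>\<^sub>\<infinity>y. (cmod (coord (ket x) y))\<^sup>2) = (\<Sum>\<^sub>\<infinity>y\<in>{x}. (cmod (coord (ket x) y))\<^sup>2)"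
    by (rule infsum_cong_neutral) (auto simp: ket.rep_eq)
  then show ?thesis by (simp add: norm_ell2_eq ket.rep_eq)
qed

lemma unit_coord_imp_multiple_of_ket:
  assumes "norm f \<le> 1" and "cmod (coord f x) = 1"
  shows "f = coord f x *\<^sub>C ket x"
proof (rule ell2_eqI)
  fix y
  have "coord f y = 0" if "y \<noteq> x"
  proof -
    have "(cmod (coord f x))\<^sup>2 + (cmod (coord f y))\<^sup>2 \<le> (norm f)\<^sup>2"
      using sum_coord_le_norm[of "{x, y}" f] that by auto
    moreover have "(norm f)\<^sup>2 \<le> 1"
      using assms(1) by (simp add: power_le_one)
    ultimately have "(cmod (coord f y))\<^sup>2 \<le> 0" unfolding assms(2) power_one by linarith
    then show ?thesis by simp
  qed
  then show "coord f y = coord (coord f x *\<^sub>C ket x) y"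
    by (auto simp: coord_simps)
qed


section \<open>Right creation and the expansion by the last letter\<close>

lift_definition right_creation :: "'n \<Rightarrow> 'n list ell2 \<Rightarrow> 'n list ell2"
  is "\<lambda>j f w. if w \<noteq> [] \<and> last w = j then f (butlast w) else 0"
proof -
  fix j :: 'n and f :: "'n list \<Rightarrow> complex"
  assume f: "(\<lambda>x. (cmod (f x))\<^sup>2) summable_on UNIV"
  let ?h = "\<lambda>w. (cmod (if w \<noteq> [] \<and> last w = j then f (butlast w) else 0))\<^sup>2"
  have inj: "inj (\<lambda>v. v @ [j])" by (simp add: inj_on_def)
  have "?h w = 0" if "w \<notin> range (\<lambda>v. v @ [j])" for w
    using that by (cases w rule: rev_cases) auto
  then have "?h summable_on UNIV \<longleftrightarrow> ?h summable_on range (\<lambda>v. v @ [j])"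
    by (intro summable_on_cong_neutral) auto
  also have "\<dots> \<longleftrightarrow> (\<lambda>x. (cmod (f x))\<^sup>2) summable_on UNIV"
    by (simp add: summable_on_reindex[OF inj] o_def)
  finally show "?h summable_on UNIV" using f by blast
qed

text \<open>The adjoint of right creation. Only its coordinates enter, as the vectors \<open>f\<^sub>j\<close> in the
  expansion \<open>f = f(1) \<xi>\<^sub>1 + (\<Sum>j. R\<^sub>j f\<^sub>j)\<close>.\<close>

lift_definition right_annihilation :: "'n \<Rightarrow> 'n list ell2 \<Rightarrow> 'n list ell2"
  is "\<lambda>j f v. f (v @ [j])"
proof -
  fix j :: 'n and f :: "'n list \<Rightarrow> complex"
  assume f: "(\<lambda>x. (cmod (f x))\<^sup>2) summable_on UNIV"
  have inj: "inj (\<lambda>v. v @ [j])" by (simp add: inj_on_def)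
  have "(\<lambda>x. (cmod (f x))\<^sup>2) summable_on range (\<lambda>v. v @ [j])"
    by (rule summable_on_subset_banach[OF f]) simp
  then show "(\<lambda>v. (cmod (f (v @ [j])))\<^sup>2) summable_on UNIV"
    by (simp add: summable_on_reindex[OF inj] o_def)
qed

lemma coord_right_creation_Nil: "coord (right_creation j f) [] = 0"
  by (simp add: right_creation.rep_eq)

lemma coord_right_creation_snoc:
  "coord (right_creation j f) (v @ [k]) = (if k = j then coord f v else 0)"
  by (simp add: right_creation.rep_eq)

lemma right_creation_add: "right_creation j (f + g) = right_creation j f + right_creation j g"
  by (rule ell2_eqI) (simp add: right_creation.rep_eq coord_simps)

lemma right_creation_scaleC: "right_creation j (c *\<^sub>C f) = c *\<^sub>C right_creation j f"
  by (rule ell2_eqI) (simp add: right_creation.rep_eq coord_simps)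

lemma right_creation_left_creation:
  "prepend_ell2 i (right_creation j f) = right_creation j (prepend_ell2 i f)"
proof (rule ell2_eqI)
  fix w
  show "coord (prepend_ell2 i (right_creation j f)) w = coord (right_creation j (prepend_ell2 i f)) w"
  proof (cases w)
    case Nil
    then show ?thesis by (simp add: prepend_ell2.rep_eq prepend_def right_creation.rep_eq)
  next
    case (Cons k v)
    then show ?thesis
      by (cases v rule: rev_cases)
        (auto simp: prepend_ell2.rep_eq prepend_def right_creation.rep_eq)
  qed
qed

lemma expansion_by_last_letter:
  fixes f :: "'n::finite list ell2"
  shows "f = coord f [] *\<^sub>C ket [] + (\<Sum>j\<in>UNIV. right_creation j (right_annihilation j f))"
proof (rule ell2_eqI)
  fix w
  show "coord f w
      = coord (coord f [] *\<^sub>C ket [] + (\<Sum>j\<in>UNIV. right_creation j (right_annihilation j f))) w"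
    by (cases w rule: rev_cases)
      (simp_all add: coord_simps coord_sum coord_right_creation_Nil coord_right_creation_snoc
        right_annihilation.rep_eq)
qed


section \<open>The commutant of right creation\<close>

definition right_commutant :: "('n list ell2 \<Rightarrow>\<^sub>L 'n list ell2) set" where
  "right_commutant = {T \<in> bounded_ops.
     \<forall>j f. blinfun_apply T (right_creation j f) = right_creation j (blinfun_apply T f)}"

lemma topspace_weak_operator_topology: "topspace weak_operator_topology = bounded_ops"
  by (simp add: weak_operator_topology_def topspace_pullback_topology)

lemma continuous_map_cinner_weak_operator_topology:
  "continuous_map weak_operator_topology euclidean (\<lambda>T. cinner (blinfun_apply T f) g)"
proof -
  have "continuous_map (product_topology (\<lambda>_. euclidean) UNIV) euclidean
      (\<lambda>h :: 'a ell2 \<times> 'a ell2 \<Rightarrow> complex. h (f, g))"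
    by (rule continuous_map_product_projection) simp
  from continuous_map_pullback[OF this, of bounded_ops
      "\<lambda>T (f, g). cinner (blinfun_apply T f) g"]
  show ?thesis
    unfolding weak_operator_topology_def by (simp add: o_def)
qed

lemma unital_subalgebra_right_commutant: "unital_subalgebra right_commutant"
proof -
  have add: "c *\<^sub>C (f + g) = c *\<^sub>C f + c *\<^sub>C g" for c and f g :: "'n list ell2"
    by (rule ell2_eqI) (simp add: coord_simps algebra_simps)
  have commute: "c *\<^sub>C d *\<^sub>C f = d *\<^sub>C c *\<^sub>C f" for c d and f :: "'n list ell2"
    by (rule ell2_eqI) (simp add: coord_simps)
  show ?thesis
    unfolding unital_subalgebra_def right_commutant_def bounded_ops_def
    by (auto simp: plus_blinfun.rep_eq scale_op_apply right_creation_add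
        right_creation_scaleC add intro: commute)
qed

text \<open>Commutation with right creation amounts to equalities between matrix coefficients: the
  coordinate of \<open>R\<^sub>j (T f)\<close> at a word is zero or a coordinate of \<open>T f\<close>. Matrix coefficients are
  continuous for the weak operator topology by its definition.\<close>

lemma closedin_right_commutant: "closedin weak_operator_topology right_commutant"
proof -
  let ?E = "\<lambda>(j, f, w). {T \<in> topspace weak_operator_topology.
    coord (blinfun_apply T (right_creation j f)) w
      = coord (right_creation j (blinfun_apply T f)) w}"
  have cont: "continuous_map weak_operator_topology euclidean (\<lambda>T. coord (blinfun_apply T f) w)"
    for f and w :: "'n list"
    using continuous_map_cinner_weak_operator_topology[of f "ket w"] by (simp add: cinner_ket)
  have "closedin weak_operator_topology (?E (j, f, w))"
    for j :: 'n and f w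
  proof -
    have "continuous_map weak_operator_topology euclidean
        (\<lambda>T. coord (right_creation j (blinfun_apply T f)) w)"
      by (cases "w \<noteq> [] \<and> last w = j") (simp_all add: right_creation.rep_eq cont)
    from closedin_continuous_maps_eq[OF _ cont this] show ?thesis by simp
  qed
  then have "closedin weak_operator_topology (\<Inter>p. ?E p)"
    by (intro closedin_INT) auto
  also have "(\<Inter>p. ?E p) = right_commutant"
    by (auto simp: right_commutant_def topspace_weak_operator_topology intro!: ell2_eqI)
  finally show ?thesis .
qed

lemma toeplitz_algebra_subset: "toeplitz_algebra \<subseteq> right_commutant"
  unfolding toeplitz_algebra_def
proof (rule hull_minimal)
  show "range left_creation \<subseteq> right_commutant"
    by (auto simp: right_commutant_def left_creation_in_bounded_ops left_creation_apply
        right_creation_left_creation)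
  show "unital_subalgebra right_commutant \<and> closedin weak_operator_topology right_commutant"
    by (simp add: unital_subalgebra_right_commutant closedin_right_commutant)
qed


section \<open>Fourier coefficients\<close>

lemma right_commutant_apply:
  fixes T :: "'n::finite list ell2 \<Rightarrow>\<^sub>L 'n list ell2"
  assumes "T \<in> right_commutant"
  shows "blinfun_apply T f = coord f [] *\<^sub>C blinfun_apply T (ket [])
    + (\<Sum>j\<in>UNIV. right_creation j (blinfun_apply T (right_annihilation j f)))"
proof -
  have "blinfun_apply T f = blinfun_apply T
      (coord f [] *\<^sub>C ket [] + (\<Sum>j\<in>UNIV. right_creation j (right_annihilation j f)))"
    using expansion_by_last_letter[of f] by simp
  then show ?thesis
    using assms by (simp add: right_commutant_def bounded_ops_def blinfun.bilinear_simps
        blinfun.sum_right)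
qed

text \<open>Reading the previous identity at the empty word, and then at a word ending in \<open>z\<^sub>j\<close>, gives
  the convolution rules for the coefficients of a product in degrees zero and one.\<close>

lemma coord_right_commutant_Nil:
  fixes T :: "'n::finite list ell2 \<Rightarrow>\<^sub>L 'n list ell2"
  assumes "T \<in> right_commutant"
  shows "coord (blinfun_apply T f) [] = coord f [] * coord (blinfun_apply T (ket [])) []"
  by (subst right_commutant_apply[OF assms])
    (simp add: coord_simps coord_sum coord_right_creation_Nil)

lemma coord_right_commutant_snoc:
  fixes T :: "'n::finite list ell2 \<Rightarrow>\<^sub>L 'n list ell2"
  assumes "T \<in> right_commutant"
  shows "coord (blinfun_apply T f) (v @ [j])
    = coord f [] * coord (blinfun_apply T (ket [])) (v @ [j])
      + coord (blinfun_apply T (right_annihilation j f)) v"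
  by (subst right_commutant_apply[OF assms])
    (simp add: coord_simps coord_sum coord_right_creation_snoc)

text \<open>Induction on the word from its right end, for all vectors \<open>f\<close> at once: as \<open>T \<xi>\<^sub>1\<close> lives on
  the empty word, the coordinate of \<open>T f\<close> at \<open>v z\<^sub>j\<close> is that of \<open>T f\<^sub>j\<close> at \<open>v\<close>, where
  \<open>f\<^sub>j(v) = f(v z\<^sub>j)\<close>.\<close>

lemma right_commutant_eq_scalar:
  fixes T :: "'n::finite list ell2 \<Rightarrow>\<^sub>L 'n list ell2"
  assumes T: "T \<in> right_commutant" and vacuum: "blinfun_apply T (ket []) = c *\<^sub>C ket []"
  shows "T = scale_op c id_blinfun"
proof -
  have "coord (blinfun_apply T f) w = c * coord f w" for f w
  proof (induction w arbitrary: f rule: rev_induct)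
    case Nil
    show ?case
      by (subst coord_right_commutant_Nil[OF T]) (simp add: vacuum coord_simps)
  next
    case (snoc j v)
    show ?case
      by (subst coord_right_commutant_snoc[OF T])
        (simp add: vacuum coord_simps snoc.IH right_annihilation.rep_eq)
  qed
  then show ?thesis
    by (intro blinfun_eqI ell2_eqI) (simp add: scale_op_apply coord_simps)
qed

lemma contraction_ket_le: "norm (blinfun_apply T (ket x)) \<le> 1" if "norm T \<le> 1"
  using norm_blinfun[of T "ket x"] that by (simp add: norm_ket)

lemma commutant_contraction_eq_scalar:
  fixes T :: "'n::finite list ell2 \<Rightarrow>\<^sub>L 'n list ell2"
  assumes "T \<in> right_commutant" and "norm T \<le> 1"
    and "cmod (coord (blinfun_apply T (ket [])) []) = 1"
  shows "\<exists>c. cmod c = 1 \<and> T = scale_op c id_blinfun"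
  using right_commutant_eq_scalar[OF assms(1)]
    unit_coord_imp_multiple_of_ket[OF contraction_ket_le[OF assms(2)] assms(3)] assms(3)
  by blast

lemma cmod_eq_1_if_mult_eq_1:
  assumes "a * b = 1" and "cmod a \<le> 1" and "cmod b \<le> 1"
  shows "cmod a = 1"
proof -
  have "1 = cmod a * cmod b" using assms(1) by (metis norm_mult norm_one)
  also have "\<dots> \<le> cmod a" using assms(3) by (simp add: mult_left_le)
  finally show ?thesis using assms(2) by simp
qed

theorem corollary2p2:
  fixes i :: "'n::finite" and B C :: "'n list ell2 \<Rightarrow>\<^sub>L 'n list ell2"
  assumes "CARD('n) \<ge> 2"
    and "B \<in> toeplitz_algebra" and "C \<in> toeplitz_algebra"
    and "norm B \<le> 1" and "norm C \<le> 1"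
    and "left_creation i = B o\<^sub>L C"
  shows "\<exists>c. cmod c = 1 \<and> (B = scale_op c id_blinfun \<or> C = scale_op c id_blinfun)"
proof -
  have B: "B \<in> right_commutant" and C: "C \<in> right_commutant"
    using assms(2,3) toeplitz_algebra_subset by auto
  define b c where "b = coord (blinfun_apply B (ket []))" and "c = coord (blinfun_apply C (ket []))"
  have le: "cmod (b w) \<le> 1" "cmod (c w) \<le> 1" for w
    unfolding b_def c_def
    by (rule order_trans[OF coord_le_norm contraction_ket_le], fact assms)+
  have BC: "blinfun_apply B (blinfun_apply C (ket [])) = ket [i]"
    using left_creation_ket[of i "[]"] by (simp add: assms(6))
  have "c [] * b [] = 0"
    using coord_right_commutant_Nil[OF B, of "blinfun_apply C (ket [])"]
    by (simp add: BC b_def c_def ket.rep_eq)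
  moreover have "c [] * b [i] + c [i] * b [] = 1"
    using coord_right_commutant_snoc[OF B, of "blinfun_apply C (ket [])" "[]" i]
    by (simp add: BC b_def c_def ket.rep_eq coord_right_commutant_Nil[OF B, of "right_annihilation _ _"]
        right_annihilation.rep_eq)
  ultimately consider "c [] * b [i] = 1" | "b [] * c [i] = 1"
    by (auto simp: mult.commute)
  then show ?thesis
  proof cases
    case 1
    then have "cmod (c []) = 1" using cmod_eq_1_if_mult_eq_1 le by blast
    then show ?thesis
      using commutant_contraction_eq_scalar[OF C assms(5)] unfolding c_def by blast
  next
    case 2
    then have "cmod (b []) = 1" using cmod_eq_1_if_mult_eq_1 le by blast
    then show ?thesis
      using commutant_contraction_eq_scalar[OF B assms(4)] unfolding b_def by blast
  qed
qed

end
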